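(* Let $n\ge 3$ and let $j$ be an integer with $1\le j\le\frac{n-1}{2}$ if $n$ is odd, and $1\le j\le m-1$ if $n=2m$ is even. Let $MM(D_{2n})_{\pi_2^j}=MM(D_{2n})U_{\pi_2^j}$ be the component associated to $\pi_2^j$ in $MM(D_{2n})$. Then the matrices $$q_1=U_{\pi_2^j},\quad q_2=iP_CU_{\pi_2^j},\quad q_3=U'_{\pi_2^j},\quad q_4=iP_CU'_{\pi_2^j}$$ form a basis of $MM(D_{2n})_{\pi_2^j}$ over $\mathbb{C}$ giving it a quaternionic structure: for all $1\le t\le 4$, $q_1q_t=q_tq_1=q_t$, and $$q_2^2=q_3^2=q_4^2=-q_1,\qquad q_2q_3q_4=-q_1.$$
   Context: $D_{2n}$ is the dihedral group with $2n$ elements, realized as the subgroup of the symmetric group $S_n$ generated by the $n$-cycle $R=(1\,2\,\dots\,n)$ and the involution $C$ given by $C(i)=n+1-i$. For $\sigma\in S_n$, $P_\sigma$ is the $n\times n$ permutation matrix with $[P_\sigma]_{ba}=1$ if $\sigma(a)=b$ and $0$ otherwise; so $P_C$ is the matrix with ones on the anti-diagonal and zeros elsewhere. $MM(D_{2n})\subseteq M(n,\mathbb{C})$ is the associative algebra over $\mathbb{C}$ generated by the $P_\sigma$, $\sigma\in D_{2n}$ (equivalently, their complex linear span). $U_{\pi_2^j}$ is the $n\times n$ matrix with $(a,b)$ entry $\frac2n\cos(2(b-a)j\pi/n)$, and $U'_{\pi_2^j}$ is the $n\times n$ matrix with $(a,b)$ entry $\frac2n\sin(2(b-a)j\pi/n)$,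 $1\le a,b\le n$. Here $\pi_2^j$ denotes the two-dimensional irreducible representation of $D_{2n}$ in which $R$ acts as rotation by $2\pi j/n$ and $C$ as reflection across the $x$-axis (extended from $\mathbb{R}^2$ to $\mathbb{C}^2$), and $MM(D_{2n})U_{\pi_2^j}$ is the simple two-sided ideal of $MM(D_{2n})$ corresponding to it. $i$ is the imaginary unit. *)

theory Defs
  imports
    "HOL-Algebra.Sym_Groups"
    "Jordan_Normal_Form.VS_Connect"
    Complex_Main
begin

definition rotR :: "nat \<Rightarrow> nat \<Rightarrow> nat" where
  "rotR n = cycle_of_list [1..<Suc n]"

(* Elements of sym_group n are functions on all of nat that fix every point outside {1..n}. *)
definition reflC :: "nat \<Rightarrow> nat \<Rightarrow> nat" where
  "reflC n = (\<lambda>i. if i \<in> {1..n} then n + 1 - i else i)"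

definition dihedral :: "nat \<Rightarrow> (nat \<Rightarrow> nat) set" where
  "dihedral n = generate (sym_group n) {rotR n, reflC n}"

(* Matrix indices in Jordan_Normal_Form start at 0, whereas permutations act on {1..n};
   hence the shift by Suc. In the two trigonometric matrices below, only the difference of
   the indices matters, so no shift is needed. *)
definition perm_matrix :: "nat \<Rightarrow> (nat \<Rightarrow> nat) \<Rightarrow> complex mat" where
  "perm_matrix n \<sigma> = mat n n (\<lambda>(b, a). if \<sigma> (Suc a) = Suc b then 1 else 0)"

(* Closure under the algebra operations; the identity matrix is the generator of \<sigma> = id. *)
inductive_set MM :: "nat \<Rightarrow> complex mat set" for n where
  gen: "\<sigma> \<in> dihedral n \<Longrightarrow> perm_matrix n \<sigma> \<in> MM n"
| add: "A \<in> MM n \<Longrightarrow> B \<in> MM n \<Longrightarrow> A + B \<in> MM n"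
| smult: "A \<in> MM n \<Longrightarrow> c \<cdot>\<^sub>m A \<in> MM n"
| mult: "A \<in> MM n \<Longrightarrow> B \<in> MM n \<Longrightarrow> A * B \<in> MM n"

definition U :: "nat \<Rightarrow> int \<Rightarrow> complex mat" where
  "U n j = mat n n (\<lambda>(a, b). complex_of_real
     (2 / real n * cos (2 * (real b - real a) * real_of_int j * pi / real n)))"

definition U' :: "nat \<Rightarrow> int \<Rightarrow> complex mat" where
  "U' n j = mat n n (\<lambda>(a, b). complex_of_real
     (2 / real n * sin (2 * (real b - real a) * real_of_int j * pi / real n)))"

definition MM_component :: "nat \<Rightarrow> int \<Rightarrow> complex mat set" where
  "MM_component n j = {A * U n j | A. A \<in> MM n}"

definition MM_component_space :: "nat \<Rightarrow> int \<Rightarrow> (complex, complex mat) module" where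
  "MM_component_space n j = (module_mat TYPE(complex) n n)\<lparr>carrier := MM_component n j\<rparr>"

lemma MM_carrier: "A \<in> MM n \<Longrightarrow> A \<in> carrier_mat n n"
  by (induction rule: MM.induct) (auto simp: perm_matrix_def)

lemma U_carrier [simp]: "U n j \<in> carrier_mat n n"
  by (simp add: U_def)

lemma vectorspace_MM_component: "vectorspace class_ring (MM_component_space n j)"
proof -
  let ?V = "module_mat TYPE(complex) n n"
  interpret V: vectorspace "class_ring :: complex ring" ?V
    by (rule matrix_vs)
  obtain \<sigma> where \<sigma>: "\<sigma> \<in> dihedral n"
    unfolding dihedral_def using generate.one by blast
  have zero: "0\<^sub>m n n \<in> MM_component n j"
  proof -
    have "0 \<cdot>\<^sub>m perm_matrix n \<sigma> \<in> MM n"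
      by (intro MM.smult MM.gen \<sigma>)
    moreover have "0\<^sub>m n n = (0 \<cdot>\<^sub>m perm_matrix n \<sigma>) * U n j"
      by (auto simp: perm_matrix_def U_def scalar_prod_def)
    ultimately show ?thesis
      unfolding MM_component_def by blast
  qed
  have add: "A + B \<in> MM_component n j"
    if "A \<in> MM_component n j" "B \<in> MM_component n j" for A B
  proof -
    from that obtain A' B' where *: "A' \<in> MM n" "B' \<in> MM n" "A = A' * U n j" "B = B' * U n j"
      unfolding MM_component_def by blast
    have "A + B = (A' + B') * U n j"
      using * by (simp add: add_mult_distrib_mat[OF MM_carrier MM_carrier U_carrier])
    with MM.add[OF *(1,2)] show ?thesis
      unfolding MM_component_def by blast
  qed
  have smult: "c \<cdot>\<^sub>m A \<in> MM_component n j" if "A \<in> MM_component n j" for c A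
  proof -
    from that obtain A' where *: "A' \<in> MM n" "A = A' * U n j"
      unfolding MM_component_def by blast
    have "c \<cdot>\<^sub>m A = (c \<cdot>\<^sub>m A') * U n j"
      using * by (simp add: mult_smult_assoc_mat[OF MM_carrier U_carrier])
    with MM.smult[OF *(1)] show ?thesis
      unfolding MM_component_def by blast
  qed
  have sub: "MM_component n j \<subseteq> carrier_mat n n"
    using MM_carrier U_carrier mult_carrier_mat unfolding MM_component_def by blast
  have "subspace class_ring (MM_component n j) ?V"
    unfolding subspace_def submodule_def
    using zero add smult sub V.vectorspace_axioms V.module_axioms
    by (auto simp: module_mat_simps)
  from V.subspace_is_vs[OF this] show ?thesis
    by (simp add: MM_component_space_def)
qed

end

theory Submission
  imports Defs
begin

text \<open>
  Put \<open>\<omega> = exp (2 \<pi> i j / n)\<close>. The bounds on \<open>j\<close> place the argument of \<open>\<omega>\<close> strictly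
  between \<open>0\<close> and \<open>\<pi>\<close>, so this \<open>n\<close>-th root of unity differs from its inverse. The two
  vectors with entries \<open>\<omega>^a\<close> and \<open>\<omega>^(-a)\<close> are then orthogonal in \<open>\<complex>^n\<close> and span a plane that is
  stable under the dihedral group: \<open>R\<close> scales each of them, and \<open>C\<close> interchanges them up to a
  scalar. Collect them as the columns of an \<open>n \<times> 2\<close> matrix \<open>B\<close> (the frame below), with
  conjugate transpose \<open>Y\<close>; orthogonality says \<open>Y B = n\<close>. Hence
  \<open>\<Phi> K = (1 / n) B K Y\<close> is an injective algebra homomorphism from the \<open>2 \<times> 2\<close> matrices to the
  \<open>n \<times> n\<close> matrices (lemmas \<open>embed_mult\<close> and \<open>embed_inject\<close>).

  Stability of the plane means that every \<open>A\<close> in \<open>MM(D_{2n})\<close> satisfies \<open>A B = B K\<close> for some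
  \<open>2 \<times> 2\<close> matrix \<open>K\<close> (lemma \<open>MM_frame\<close>). Conversely every \<open>K\<close> arises in this way (lemma
  \<open>frame_MM\<close>): \<open>R\<close> acts on the plane as a diagonal matrix with distinct eigenvalues, \<open>C\<close> as an
  off-diagonal one, and two such matrices generate the whole matrix algebra. As
  \<open>U = \<Phi> 1\<close> and \<open>A B = B K\<close> gives \<open>A (\<Phi> 1) = \<Phi> K\<close>, the component \<open>MM(D_{2n}) U\<close> is exactly the
  image of \<open>\<Phi>\<close> (lemma \<open>ideal_eq_range_embed\<close>).

  So the theorem only concerns \<open>2 \<times> 2\<close> matrices. There \<open>U'\<close> corresponds to
  \<open>diag(i, -i)\<close> and \<open>P_C\<close> to the matrix of the involution that exchanges the two basis vectors,
  and the four matrices \<open>q_t\<close> correspond to the identity and three anticommuting square roots of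
  \<open>-1\<close>, the usual realisation of the quaternion units.
\<close>

section \<open>Two-by-two matrices and matrix algebra\<close>

definition mat2 :: "complex \<Rightarrow> complex \<Rightarrow> complex \<Rightarrow> complex \<Rightarrow> complex mat" where
  "mat2 a b c d = mat 2 2 (\<lambda>(r, s). if r = 0 then if s = 0 then a else b
                                     else if s = 0 then c else d)"

lemma mat2_carrier [simp]: "mat2 a b c d \<in> carrier_mat 2 2"
  by (simp add: mat2_def)

lemma mat2_cases:
  assumes "K \<in> carrier_mat 2 2"
  obtains a b c d where "K = mat2 a b c d"
proof
  show "K = mat2 (K $$ (0, 0)) (K $$ (0, 1)) (K $$ (1, 0)) (K $$ (1, 1))"
    using assms by (intro eq_matI) (auto simp: mat2_def less_2_cases_iff)
qed

lemma mat2_eq_iff: "mat2 a b c d = mat2 a' b' c' d' \<longleftrightarrow> a = a' \<and> b = b' \<and> c = c' \<and> d = d'"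
proof
  assume eq: "mat2 a b c d = mat2 a' b' c' d'"
  have "mat2 a b c d $$ (r, s) = mat2 a' b' c' d' $$ (r, s)" for r s
    by (simp add: eq)
  from this[of 0 0] this[of 0 1] this[of 1 0] this[of 1 1]
  show "a = a' \<and> b = b' \<and> c = c' \<and> d = d'"
    by (simp add: mat2_def)
qed simp

lemma mat2_mult:
  "mat2 a b c d * mat2 a' b' c' d' =
     mat2 (a * a' + b * c') (a * b' + b * d') (c * a' + d * c') (c * b' + d * d')"
  by (intro eq_matI) (auto simp: mat2_def scalar_prod_def numeral_2_eq_2 less_Suc_eq)

lemma mat2_add: "mat2 a b c d + mat2 a' b' c' d' = mat2 (a + a') (b + b') (c + c') (d + d')"
  by (intro eq_matI) (auto simp: mat2_def)

lemma mat2_smult: "x \<cdot>\<^sub>m mat2 a b c d = mat2 (x * a) (x * b) (x * c) (x * d)"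
  by (intro eq_matI) (auto simp: mat2_def)

lemma mat2_uminus: "- mat2 a b c d = mat2 (- a) (- b) (- c) (- d)"
  by (intro eq_matI) (auto simp: mat2_def)

lemma mat2_one: "1\<^sub>m 2 = mat2 1 0 0 1"
  by (intro eq_matI) (auto simp: mat2_def)

text \<open>The laws of matrix algebra with premises on dimensions. A premise of the form
  \<open>A \<in> carrier_mat nr nc\<close> leaves \<open>nr\<close> and \<open>nc\<close> undetermined when the law is used for rewriting;
  an equation between dimensions is decided by simplification.\<close>

lemma mat_algebra_dim:
  fixes A B C :: "complex mat"
  shows "dim_col A = dim_row B \<Longrightarrow> dim_col B = dim_row C \<Longrightarrow> A * B * C = A * (B * C)"
    and "dim_col A = dim_row B \<Longrightarrow> (x \<cdot>\<^sub>m A) * B = x \<cdot>\<^sub>m (A * B)"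
    and "dim_col A = dim_row B \<Longrightarrow> A * (x \<cdot>\<^sub>m B) = x \<cdot>\<^sub>m (A * B)"
    and "dim_row A = dim_row B \<Longrightarrow> dim_col A = dim_col B \<Longrightarrow> dim_col B = dim_row C
      \<Longrightarrow> (A + B) * C = A * C + B * C"
    and "dim_col A = dim_row B \<Longrightarrow> dim_row B = dim_row C \<Longrightarrow> dim_col B = dim_col C
      \<Longrightarrow> A * (B + C) = A * B + A * C"
    and "dim_row A = dim_row B \<Longrightarrow> dim_col A = dim_col B
      \<Longrightarrow> x \<cdot>\<^sub>m (A + B) = x \<cdot>\<^sub>m A + x \<cdot>\<^sub>m B"
    and "x \<cdot>\<^sub>m (y \<cdot>\<^sub>m A) = (x * y) \<cdot>\<^sub>m A"
  by (intro assoc_mult_mat mult_smult_assoc_mat mult_smult_distrib add_mult_distrib_mat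
      mult_add_distrib_mat add_smult_distrib_left_mat; auto)+ (auto intro: eq_matI)

lemmas mat2_simps = mat2_mult mat2_add mat2_smult mat2_uminus mat2_eq_iff

section \<open>Permutation matrices of the dihedral group\<close>

lemma perm_matrix_carrier [simp]: "perm_matrix n \<sigma> \<in> carrier_mat n n"
  by (simp add: perm_matrix_def)

text \<open>Multiplication by \<open>P_\<sigma>\<close> moves row \<open>a\<close> to the row \<open>b\<close> that is the image of \<open>a\<close>. Naming the
  preimage \<open>a\<close> of the row \<open>b\<close> avoids inverse permutations.\<close>

lemma perm_matrix_mult_row:
  assumes M: "M \<in> carrier_mat n m" and \<sigma>: "\<sigma> permutes {1..n}"
    and ab: "a < n" "\<sigma> (Suc a) = Suc b" "b < n" and c: "c < m"
  shows "(perm_matrix n \<sigma> * M) $$ (b, c) = M $$ (a, c)"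
proof -
  have "\<sigma> (Suc k) = Suc b \<longleftrightarrow> k = a" for k
    using permutes_inj[OF \<sigma>] ab by (metis injD Suc_inject)
  then have "(perm_matrix n \<sigma> * M) $$ (b, c)
      = (\<Sum>k = 0..<n. (if k = a then 1 else 0) * M $$ (k, c))"
    using M ab c by (simp add: perm_matrix_def scalar_prod_def)
  also have "\<dots> = (\<Sum>k = 0..<n. if k = a then M $$ (k, c) else 0)"
    by (intro sum.cong) auto
  finally show ?thesis using ab by simp
qed

lemma perm_matrix_id: "perm_matrix n id = 1\<^sub>m n"
  by (intro eq_matI) (auto simp: perm_matrix_def)

lemma perm_matrix_comp:
  assumes \<tau>: "\<tau> permutes {1..n}"
  shows "perm_matrix n (\<sigma> \<circ> \<tau>) = perm_matrix n \<sigma> * perm_matrix n \<tau>"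
proof (intro eq_matI)
  fix b a assume "b < dim_row (perm_matrix n \<sigma> * perm_matrix n \<tau>)"
    and "a < dim_col (perm_matrix n \<sigma> * perm_matrix n \<tau>)"
  then have ab: "a < n" "b < n" by (simp_all add: perm_matrix_def)
  then have "\<tau> (Suc a) \<in> {1..n}"
    using permutes_in_image[OF \<tau>, of "Suc a"] by simp
  then obtain k where k: "\<tau> (Suc a) = Suc k" "k < n"
    by (cases "\<tau> (Suc a)") auto
  have "(perm_matrix n \<sigma> * perm_matrix n \<tau>) $$ (b, a)
      = (\<Sum>l = 0..<n. (if \<sigma> (Suc l) = Suc b then 1 else 0) * (if k = l then 1 else 0))"
    using ab k by (simp add: perm_matrix_def scalar_prod_def)
  also have "\<dots> = (\<Sum>l = 0..<n. if l = k then if \<sigma> (Suc l) = Suc b then 1 else 0 else 0)"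
    by (intro sum.cong) auto
  finally have "(perm_matrix n \<sigma> * perm_matrix n \<tau>) $$ (b, a)
      = (if \<sigma> (Suc k) = Suc b then 1 else 0)"
    using k by simp
  with ab k show "perm_matrix n (\<sigma> \<circ> \<tau>) $$ (b, a) = (perm_matrix n \<sigma> * perm_matrix n \<tau>) $$ (b, a)"
    by (simp add: perm_matrix_def)
qed (simp_all add: perm_matrix_def)

lemma reflC_permutes: "reflC n permutes {1..n}"
proof (rule bij_imp_permutes)
  show "bij_betw (reflC n) {1..n} {1..n}"
    by (rule bij_betwI[of _ _ _ "reflC n"]) (auto simp: reflC_def)
qed (auto simp: reflC_def)

lemma rotR_permutes: "rotR n permutes {1..n}"
proof -
  have "set [1..<Suc n] = {1..n}" by auto
  then show ?thesis
    unfolding rotR_def using cycle_permutes[of "[1..<Suc n]"] by simp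
qed

text \<open>With indices counted from \<open>0\<close>, the \<open>n\<close>-cycle is addition of \<open>1\<close> modulo \<open>n\<close>.\<close>

lemma rotR_eq:
  assumes "a < n"
  shows "rotR n (Suc a) = Suc (Suc a mod n)"
proof -
  have "map (rotR n) [1..<Suc n] = rotate 1 [1..<Suc n]"
    unfolding rotR_def using cyclic_rotation[of "[1..<Suc n]" 1] by simp
  then have "map (rotR n) [1..<Suc n] ! a = rotate 1 [1..<Suc n] ! a" by (rule arg_cong)
  with assms show ?thesis
    by (simp add: nth_rotate del: upt_Suc rotate_Suc One_nat_def) simp
qed

lemma perm_matrix_inv:
  assumes "\<sigma> permutes {1..n}"
  shows "perm_matrix n (inv' \<sigma>) * perm_matrix n \<sigma> = 1\<^sub>m n"
  using assms by (simp add: perm_matrix_comp[symmetric] permutes_inv permutes_inv_o perm_matrix_id)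

lemma dihedral_permutes: "\<sigma> \<in> dihedral n \<Longrightarrow> \<sigma> permutes {1..n}"
  using group.generate_in_carrier[OF sym_group_is_group, of "{rotR n, reflC n}" n \<sigma>]
    rotR_permutes reflC_permutes
  by (auto simp: dihedral_def sym_group_carrier)

section \<open>The plane spanned by two conjugate harmonics\<close>

text \<open>The last condition says that \<open>\<omega>\<close> and \<open>inverse \<omega>\<close> are different, so that the two harmonics
  \<open>\<omega>^a\<close> and \<open>\<omega>^(-a)\<close> are orthogonal.\<close>

locale harmonic_pair =
  fixes n :: nat and \<omega> :: complex
  assumes n_pos: "n > 0" and root: "\<omega> ^ n = 1" and nonreal: "\<omega>\<^sup>2 \<noteq> 1"
begin

lemma nonzero [simp]: "\<omega> \<noteq> 0"
  using root n_pos by (auto simp: power_0_left)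

lemma not_self_inverse: "\<omega> \<noteq> inverse \<omega>"
  using nonreal by (metis nonzero power2_eq_square right_inverse)

definition frame :: "complex mat" where
  "frame = mat n 2 (\<lambda>(a, s). (if s = 0 then \<omega> else inverse \<omega>) ^ a)"

definition coframe :: "complex mat" where
  "coframe = mat 2 n (\<lambda>(s, b). (if s = 0 then inverse \<omega> else \<omega>) ^ b)"

lemma frame_carrier [simp]: "frame \<in> carrier_mat n 2"
  and coframe_carrier [simp]: "coframe \<in> carrier_mat 2 n"
  and frame_dim [simp]: "dim_row frame = n" "dim_col frame = 2"
  and coframe_dim [simp]: "dim_row coframe = 2" "dim_col coframe = n"
  by (simp_all add: frame_def coframe_def)

text \<open>The off-diagonal entries are the geometric sums of \<open>\<omega>^2\<close> and \<open>\<omega>^(-2)\<close>, which vanish because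
  these are \<open>n\<close>-th roots of unity other than \<open>1\<close>; the diagonal entries add up \<open>n\<close> ones.\<close>

lemma coframe_frame: "coframe * frame = of_nat n \<cdot>\<^sub>m 1\<^sub>m 2"
proof -
  have zero: "(\<Sum>k = 0..<n. x ^ k * x ^ k) = 0" if "x ^ n = 1" "x\<^sup>2 \<noteq> 1" for x :: complex
  proof -
    have "(\<Sum>k = 0..<n. x ^ k * x ^ k) = (\<Sum>k<n. (x\<^sup>2) ^ k)"
      by (simp add: lessThan_atLeast0 power2_eq_square power_mult_distrib)
    also have "\<dots> = ((x\<^sup>2) ^ n - 1) / (x\<^sup>2 - 1)"
      using that(2) by (rule geometric_sum)
    also have "(x\<^sup>2) ^ n = (x ^ n)\<^sup>2"
      by (simp add: mult.commute flip: power_mult)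
    also have "\<dots> = 1"
      using that(1) by simp
    finally show ?thesis by simp
  qed
  have inv: "inverse \<omega> ^ n = 1" "(inverse \<omega>)\<^sup>2 \<noteq> 1"
    using root nonreal by (simp_all add: power_inverse)
  have one: "(\<Sum>k = 0..<n. inverse \<omega> ^ k * \<omega> ^ k) = of_nat n"
    "(\<Sum>k = 0..<n. \<omega> ^ k * inverse \<omega> ^ k) = of_nat n"
    by (simp_all flip: power_mult_distrib)
  show ?thesis
    using zero[OF root nonreal] zero[OF inv] one
    by (intro eq_matI) (auto simp: frame_def coframe_def scalar_prod_def less_2_cases_iff)
qed

text \<open>The endomorphism of \<open>\<complex>^n\<close> that acts on the plane by \<open>K\<close>, in the basis given by the columns of
  the frame, and annihilates the orthogonal complement of the plane.\<close>

definition embed :: "complex mat \<Rightarrow> complex mat" where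
  "embed K = (1 / of_nat n) \<cdot>\<^sub>m (frame * K * coframe)"

lemma embed_dim [simp]: "dim_row (embed K) = n" "dim_col (embed K) = n"
  by (simp_all add: embed_def)

lemma embed_carrier [simp]: "embed K \<in> carrier_mat n n"
  by (intro carrier_matI) simp_all

lemma embed_frame:
  assumes K: "K \<in> carrier_mat 2 2"
  shows "embed K * frame = frame * K"
  using K n_pos by (simp add: embed_def mat_algebra_dim coframe_frame) (auto intro: eq_matI)

text \<open>An equation \<open>A * frame = frame * K\<close> says that \<open>A\<close> preserves the plane and acts on it as \<open>K\<close>.
  Left multiplication by \<open>A\<close> then stays inside the image of \<open>embed\<close>; taking \<open>A\<close> itself in that
  image gives multiplicativity of \<open>embed\<close>.\<close>

lemma intertwine_embed:
  assumes A: "A \<in> carrier_mat n n" and K: "K \<in> carrier_mat 2 2" and L: "L \<in> carrier_mat 2 2"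
    and AK: "A * frame = frame * K"
  shows "A * embed L = embed (K * L)"
proof -
  have "A * embed L = (1 / of_nat n) \<cdot>\<^sub>m ((A * frame) * (L * coframe))"
    using A L by (simp add: embed_def mat_algebra_dim)
  then show ?thesis
    unfolding AK using K L by (simp add: embed_def mat_algebra_dim)
qed

lemma embed_mult:
  assumes "K \<in> carrier_mat 2 2" "L \<in> carrier_mat 2 2"
  shows "embed K * embed L = embed (K * L)"
  using assms by (intro intertwine_embed embed_frame embed_carrier)

lemma embed_add:
  assumes "K \<in> carrier_mat 2 2" "L \<in> carrier_mat 2 2"
  shows "embed (K + L) = embed K + embed L"
  using assms by (simp add: embed_def mat_algebra_dim)

lemma embed_smult:
  assumes "K \<in> carrier_mat 2 2"
  shows "embed (x \<cdot>\<^sub>m K) = x \<cdot>\<^sub>m embed K"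
  using assms by (simp add: embed_def mat_algebra_dim)

lemma embed_uminus:
  assumes "K \<in> carrier_mat 2 2"
  shows "embed (- K) = - embed K"
proof -
  have neg: "- M = (- 1) \<cdot>\<^sub>m M" for M :: "complex mat" by (intro eq_matI) auto
  show ?thesis unfolding neg by (rule embed_smult[OF assms])
qed

text \<open>\<open>K\<close> is recovered from its action on the plane, since the coframe is a left inverse of the
  frame up to the factor \<open>n\<close>.\<close>

lemma embed_inject:
  assumes K: "K \<in> carrier_mat 2 2" and L: "L \<in> carrier_mat 2 2" and eq: "embed K = embed L"
  shows "K = L"
proof -
  have *: "(1 / of_nat n) \<cdot>\<^sub>m (coframe * (frame * M)) = M" if M: "M \<in> carrier_mat 2 2" for M
  proof -
    have "coframe * (frame * M) = of_nat n \<cdot>\<^sub>m M"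
      using M by (simp add: coframe_frame mult_smult_assoc_mat[of _ 2 2]
          flip: assoc_mult_mat[of _ 2 n _ 2 _ 2])
    then show ?thesis using M n_pos by (intro eq_matI) auto
  qed
  have "frame * K = frame * L"
    using embed_frame[OF K] embed_frame[OF L] eq by simp
  with *[OF K] *[OF L] show ?thesis by metis
qed

lemma embed_mat2_entry:
  assumes "r < n" "s < n"
  shows "embed (mat2 a b c d) $$ (r, s) =
     (a * (\<omega> ^ r * inverse \<omega> ^ s) + b * (\<omega> ^ r * \<omega> ^ s)
      + c * (inverse \<omega> ^ r * inverse \<omega> ^ s) + d * (inverse \<omega> ^ r * \<omega> ^ s)) / of_nat n"
  using assms
  by (simp add: embed_def mat2_def frame_def coframe_def scalar_prod_def numeral_2_eq_2
      field_simps)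

section \<open>The component as an image of the two-by-two matrices\<close>

text \<open>The action of \<open>C\<close> on the plane. Counted from \<open>0\<close>, \<open>C\<close> sends \<open>a\<close> to \<open>n - 1 - a\<close>, and
  \<open>\<omega>^(n - 1 - a) = \<omega>^(-1) \<omega>^(-a)\<close>: the harmonics are exchanged with an additional factor
  \<open>\<omega>\<close> or its inverse.\<close>

definition refl2 :: "complex mat" where
  "refl2 = mat2 0 \<omega> (inverse \<omega>) 0"

lemma refl2_carrier [simp]: "refl2 \<in> carrier_mat 2 2"
  by (simp add: refl2_def)

lemma rotation_frame: "perm_matrix n (rotR n) * frame = frame * mat2 (inverse \<omega>) 0 0 \<omega>"
proof (intro eq_matI)
  fix b s assume "b < dim_row (frame * mat2 (inverse \<omega>) 0 0 \<omega>)"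
    and "s < dim_col (frame * mat2 (inverse \<omega>) 0 0 \<omega>)"
  then have bs: "b < n" "s < 2" by (simp_all add: frame_def mat2_def)
  (* a is the index that the n-cycle sends to b; the wrap-around at b = 0 is absorbed by x ^ n = 1 *)
  define a where "a = (if b = 0 then n - 1 else b - 1)"
  have a: "a < n" "Suc a mod n = b" using bs n_pos by (auto simp: a_def)
  have "Suc a = n \<and> b = 0 \<or> Suc a = b" using a(2) bs n_pos by (auto simp: a_def)
  then have pow: "x ^ Suc a = x ^ b" if "x ^ n = 1" for x :: complex
    using that by (metis power_0)
  have "(perm_matrix n (rotR n) * frame) $$ (b, s) = frame $$ (a, s)"
    using bs a by (intro perm_matrix_mult_row[OF frame_carrier rotR_permutes]) (auto simp: rotR_eq)
  also have "\<dots> = (frame * mat2 (inverse \<omega>) 0 0 \<omega>) $$ (b, s)"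
    using bs a pow[OF root] pow[of "inverse \<omega>"] root
    by (auto simp: less_2_cases_iff frame_def mat2_def scalar_prod_def numeral_2_eq_2
        power_inverse field_simps)
  finally show "(perm_matrix n (rotR n) * frame) $$ (b, s)
      = (frame * mat2 (inverse \<omega>) 0 0 \<omega>) $$ (b, s)" .
qed (simp_all add: frame_def perm_matrix_def mat2_def)

lemma reflection_frame: "perm_matrix n (reflC n) * frame = frame * refl2"
proof (intro eq_matI)
  fix b s assume "b < dim_row (frame * refl2)" and "s < dim_col (frame * refl2)"
  then have bs: "b < n" "s < 2" by (simp_all add: frame_def refl2_def mat2_def)
  define a where "a = n - Suc b"
  have a: "a < n" "a + b + 1 = n" using bs by (auto simp: a_def)
  have "\<omega> ^ a * \<omega> ^ b * \<omega> = 1"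
    using root a(2) by (metis power_add power_one_right)
  then have pow: "\<omega> ^ a = inverse \<omega> * inverse \<omega> ^ b" "inverse \<omega> ^ a = \<omega> * \<omega> ^ b"
    by (simp_all add: power_inverse field_simps)
  have "(perm_matrix n (reflC n) * frame) $$ (b, s) = frame $$ (a, s)"
    using bs a by (intro perm_matrix_mult_row[OF frame_carrier reflC_permutes]) (auto simp: reflC_def)
  also have "\<dots> = (frame * refl2) $$ (b, s)"
    using bs a pow
    by (auto simp: less_2_cases_iff frame_def refl2_def mat2_def scalar_prod_def numeral_2_eq_2)
  finally show "(perm_matrix n (reflC n) * frame) $$ (b, s) = (frame * refl2) $$ (b, s)" .
qed (simp_all add: frame_def perm_matrix_def refl2_def mat2_def)

text \<open>The matrices that preserve the plane form an algebra, closed under inverting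
  a matrix that acts invertibly on the plane. The closure properties below carry the generators \<open>R\<close> and \<open>C\<close> to
  the dihedral group and then to its matrix algebra.\<close>

lemma intertwine_comp:
  assumes A: "A \<in> carrier_mat n n" "A' \<in> carrier_mat n n"
    and K: "K \<in> carrier_mat 2 2" "K' \<in> carrier_mat 2 2"
    and eq: "A * frame = frame * K" "A' * frame = frame * K'"
  shows "(A * A') * frame = frame * (K * K')"
proof -
  have "(A * A') * frame = A * (A' * frame)" using A by (simp add: mat_algebra_dim)
  also have "\<dots> = (A * frame) * K'" using A K by (simp add: eq(2) mat_algebra_dim)
  finally show ?thesis using K by (simp add: eq(1) mat_algebra_dim)
qed

lemma intertwine_inverse:
  assumes A: "A \<in> carrier_mat n n" "A' \<in> carrier_mat n n" "A' * A = 1\<^sub>m n"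
    and K: "K \<in> carrier_mat 2 2" "K' \<in> carrier_mat 2 2" "K * K' = 1\<^sub>m 2"
    and eq: "A * frame = frame * K"
  shows "A' * frame = frame * K'"
proof -
  have "A' * frame = A' * (frame * (K * K'))" by (simp add: K(3))
  also have "\<dots> = A' * (A * frame * K')" unfolding eq using K by (simp add: mat_algebra_dim)
  also have "\<dots> = (A' * A) * (frame * K')" using A(1,2) K by (simp add: mat_algebra_dim)
  also have "\<dots> = frame * K'" unfolding A(3) using K by simp
  finally show ?thesis .
qed

lemma dihedral_frame:
  assumes "\<sigma> \<in> dihedral n"
  shows "\<exists>K\<in>carrier_mat 2 2. perm_matrix n \<sigma> * frame = frame * K"
  using assms unfolding dihedral_def
proof (induction rule: generate.induct)
  case one
  show ?case
    by (intro bexI[of _ "1\<^sub>m 2"]) (simp_all add: sym_group_one perm_matrix_id del: id_apply)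
next
  case (incl \<sigma>)
  then show ?case using rotation_frame reflection_frame mat2_carrier refl2_carrier by blast
next
  case (inv \<sigma>)
  have inv_eq: "inv\<^bsub>sym_group n\<^esub> \<sigma> = inv' \<sigma>" and \<sigma>: "\<sigma> permutes {1..n}"
    using inv rotR_permutes reflC_permutes by (auto simp: sym_group_carrier)
  (* Inverses are taken of generators only, and the action of each generator has an explicit inverse. *)
  have "\<exists>K K'. K \<in> carrier_mat 2 2 \<and> K' \<in> carrier_mat 2 2 \<and> K * K' = 1\<^sub>m 2
      \<and> perm_matrix n \<sigma> * frame = frame * K"
  proof (cases "\<sigma> = rotR n")
    case True
    then show ?thesis
      by (intro exI[of _ "mat2 (inverse \<omega>) 0 0 \<omega>"] exI[of _ "mat2 \<omega> 0 0 (inverse \<omega>)"])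
         (simp add: rotation_frame mat2_one mat2_simps)
  next
    case False
    with inv have "\<sigma> = reflC n" by simp
    then show ?thesis
      by (intro exI[of _ refl2]) (simp add: reflection_frame, simp add: refl2_def mat2_one mat2_simps)
  qed
  with perm_matrix_inv[OF \<sigma>] show ?case
    unfolding inv_eq using intertwine_inverse perm_matrix_carrier by blast
next
  case (eng \<sigma> \<tau>)
  have "\<tau> permutes {1..n}"
    using eng.hyps dihedral_permutes by (simp add: dihedral_def)
  then have comp: "perm_matrix n (\<sigma> \<circ> \<tau>) = perm_matrix n \<sigma> * perm_matrix n \<tau>"
    by (rule perm_matrix_comp)
  from eng.IH obtain K L where "K \<in> carrier_mat 2 2" "L \<in> carrier_mat 2 2"
    "perm_matrix n \<sigma> * frame = frame * K" "perm_matrix n \<tau> * frame = frame * L" by blast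
  with intertwine_comp[of "perm_matrix n \<sigma>" "perm_matrix n \<tau>" K L] show ?case
    unfolding sym_group_mult comp
    by (intro bexI[of _ "K * L"]) (simp_all add: mult_carrier_mat[of _ 2 2])
qed

lemma intertwine_add:
  assumes A: "A \<in> carrier_mat n n" "A' \<in> carrier_mat n n"
    and K: "K \<in> carrier_mat 2 2" "K' \<in> carrier_mat 2 2"
    and eq: "A * frame = frame * K" "A' * frame = frame * K'"
  shows "(A + A') * frame = frame * (K + K')"
  using A K eq by (simp add: mat_algebra_dim)

lemma intertwine_smult:
  assumes A: "A \<in> carrier_mat n n" and K: "K \<in> carrier_mat 2 2"
    and eq: "A * frame = frame * K"
  shows "(x \<cdot>\<^sub>m A) * frame = frame * (x \<cdot>\<^sub>m K)"
  using A K eq by (simp add: mat_algebra_dim)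

lemma MM_frame:
  assumes "A \<in> MM n"
  shows "\<exists>K\<in>carrier_mat 2 2. A * frame = frame * K"
  using assms
proof (induction rule: MM.induct)
  case (gen \<sigma>)
  then show ?case by (rule dihedral_frame)
next
  case (add A B)
  then show ?case
    by (metis MM_carrier add_carrier_mat intertwine_add)
next
  case (smult A c)
  then show ?case
    by (metis MM_carrier smult_carrier_mat intertwine_smult)
next
  case (mult A B)
  then show ?case
    by (metis MM_carrier mult_carrier_mat intertwine_comp)
qed

text \<open>The action on the plane is irreducible, so the image of the algebra is all of the
  \<open>2 \<times> 2\<close> matrices. Concretely, a rotation with distinct eigenvalues and the identity span the diagonal
  matrices, and multiplying these by the reflection produces the off-diagonal ones.\<close>

lemma frame_MM:
  assumes K: "K \<in> carrier_mat 2 2"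
  shows "\<exists>A\<in>MM n. A * frame = frame * K"
proof -
  let ?R = "perm_matrix n (rotR n)" and ?C = "perm_matrix n (reflC n)"
  have mem: "?R \<in> MM n" "?C \<in> MM n" "1\<^sub>m n \<in> MM n"
    using MM.gen[of id n]
    by (auto intro!: MM.gen simp: perm_matrix_id dihedral_def generate.incl
        generate.one[of "sym_group n", unfolded sym_group_one])
  have diag: "\<exists>A\<in>MM n. A * frame = frame * mat2 a 0 0 d" for a d
  proof -
    (* x and y solve x + y * inverse \<omega> = a and x + y * \<omega> = d *)
    define y where "y = (d - a) / (\<omega> - inverse \<omega>)"
    define x where "x = a - y * inverse \<omega>"
    have "x + y * \<omega> = d"
    proof -
      have "x + y * \<omega> = a + y * (\<omega> - inverse \<omega>)"
        by (simp add: x_def algebra_simps)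
      then show ?thesis using not_self_inverse by (simp add: y_def)
    qed
    then have "x \<cdot>\<^sub>m 1\<^sub>m 2 + y \<cdot>\<^sub>m mat2 (inverse \<omega>) 0 0 \<omega> = mat2 a 0 0 d"
      by (simp add: mat2_one mat2_simps) (simp add: x_def)
    moreover have "(x \<cdot>\<^sub>m 1\<^sub>m n + y \<cdot>\<^sub>m ?R) * frame
        = frame * (x \<cdot>\<^sub>m 1\<^sub>m 2 + y \<cdot>\<^sub>m mat2 (inverse \<omega>) 0 0 \<omega>)"
      by (intro intertwine_add intertwine_smult rotation_frame) simp_all
    ultimately show ?thesis
      using mem by (intro bexI[of _ "x \<cdot>\<^sub>m 1\<^sub>m n + y \<cdot>\<^sub>m ?R"]) (auto intro: MM.intros)
  qed
  from K obtain a b c d where K_eq: "K = mat2 a b c d" by (rule mat2_cases)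
  obtain A where A: "A \<in> MM n" "A * frame = frame * mat2 a 0 0 d" using diag by blast
  obtain B where B: "B \<in> MM n" "B * frame = frame * mat2 (\<omega> * c) 0 0 (inverse \<omega> * b)"
    using diag by blast
  have "(A + ?C * B) * frame
      = frame * (mat2 a 0 0 d + refl2 * mat2 (\<omega> * c) 0 0 (inverse \<omega> * b))"
    using A B MM_carrier
    by (intro intertwine_add intertwine_comp reflection_frame)
       (auto intro!: mult_carrier_mat[of _ n n] mult_carrier_mat[of _ 2 2])
  moreover have "mat2 a 0 0 d + refl2 * mat2 (\<omega> * c) 0 0 (inverse \<omega> * b) = K"
    by (simp add: refl2_def K_eq mat2_simps)
  ultimately show ?thesis
    using A B mem by (intro bexI[of _ "A + ?C * B"]) (auto intro: MM.intros)
qed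

lemma ideal_eq_range_embed:
  "{A * embed (1\<^sub>m 2) | A. A \<in> MM n} = embed ` carrier_mat 2 2"
proof -
  have *: "A * embed (1\<^sub>m 2) = embed K"
    if "A \<in> MM n" "K \<in> carrier_mat 2 2" "A * frame = frame * K" for A K
    using intertwine_embed[of A K "1\<^sub>m 2"] that MM_carrier by simp
  show ?thesis
  proof (intro subset_antisym subsetI)
    fix M assume "M \<in> {A * embed (1\<^sub>m 2) | A. A \<in> MM n}"
    with * MM_frame show "M \<in> embed ` carrier_mat 2 2" by blast
  next
    fix M assume "M \<in> embed ` carrier_mat 2 2"
    then obtain K where "K \<in> carrier_mat 2 2" "M = embed K" by blast
    with *[of _ K] frame_MM[of K] show "M \<in> {A * embed (1\<^sub>m 2) | A. A \<in> MM n}"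
      by (smt (verit) mem_Collect_eq)
  qed
qed

end

section \<open>The quaternion basis\<close>

text \<open>Linear combinations over a set take coefficients that are functions on that set. For four
  distinct vectors this criterion replaces them by four scalars; the condition on the cardinality
  guarantees that these can be chosen independently.\<close>

lemma (in vectorspace) basis_of_four:
  assumes mem: "{u, v, w, z} \<subseteq> carrier V"
    and card: "card {u, v, w, z} = 4"
    and spans: "\<And>x. x \<in> carrier V \<Longrightarrow> \<exists>a\<in>carrier K. \<exists>b\<in>carrier K. \<exists>c\<in>carrier K. \<exists>d\<in>carrier K.
      x = (a \<odot>\<^bsub>V\<^esub> u) \<oplus>\<^bsub>V\<^esub> ((b \<odot>\<^bsub>V\<^esub> v) \<oplus>\<^bsub>V\<^esub> ((c \<odot>\<^bsub>V\<^esub> w) \<oplus>\<^bsub>V\<^esub> (d \<odot>\<^bsub>V\<^esub> z)))"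
    and indep: "\<And>a b c d. \<lbrakk>a \<in> carrier K; b \<in> carrier K; c \<in> carrier K; d \<in> carrier K;
      (a \<odot>\<^bsub>V\<^esub> u) \<oplus>\<^bsub>V\<^esub> ((b \<odot>\<^bsub>V\<^esub> v) \<oplus>\<^bsub>V\<^esub> ((c \<odot>\<^bsub>V\<^esub> w) \<oplus>\<^bsub>V\<^esub> (d \<odot>\<^bsub>V\<^esub> z))) = \<zero>\<^bsub>V\<^esub>\<rbrakk>
      \<Longrightarrow> a = \<zero>\<^bsub>K\<^esub> \<and> b = \<zero>\<^bsub>K\<^esub> \<and> c = \<zero>\<^bsub>K\<^esub> \<and> d = \<zero>\<^bsub>K\<^esub>"
  shows "basis {u, v, w, z}"
proof -
  have dist: "u \<notin> {v, w, z}" "v \<notin> {w, z}" "w \<noteq> z"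
    using card by (auto simp: card_insert_if split: if_splits)
  have lincomb: "lincomb f {u, v, w, z} = (f u \<odot>\<^bsub>V\<^esub> u) \<oplus>\<^bsub>V\<^esub> ((f v \<odot>\<^bsub>V\<^esub> v) \<oplus>\<^bsub>V\<^esub>
      ((f w \<odot>\<^bsub>V\<^esub> w) \<oplus>\<^bsub>V\<^esub> (f z \<odot>\<^bsub>V\<^esub> z)))" if "f \<in> {u, v, w, z} \<rightarrow> carrier K" for f
    using that mem dist by (simp add: lincomb_def finsum_insert Pi_def)
  have "lin_indpt {u, v, w, z}"
  proof (rule finite_lin_indpt2)
    fix f assume f: "f \<in> {u, v, w, z} \<rightarrow> carrier K" and zero: "lincomb f {u, v, w, z} = \<zero>\<^bsub>V\<^esub>"
    show "\<forall>x\<in>{u, v, w, z}. f x = \<zero>\<^bsub>K\<^esub>"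
      using indep[of "f u" "f v" "f w" "f z"] f zero unfolding lincomb[OF f] by (auto simp: Pi_def)
  qed (use mem in auto)
  moreover have "carrier V \<subseteq> span {u, v, w, z}"
  proof
    fix x assume "x \<in> carrier V"
    from spans[OF this] obtain a b c d where K: "a \<in> carrier K" "b \<in> carrier K" "c \<in> carrier K" "d \<in> carrier K"
      and x: "x = (a \<odot>\<^bsub>V\<^esub> u) \<oplus>\<^bsub>V\<^esub> ((b \<odot>\<^bsub>V\<^esub> v) \<oplus>\<^bsub>V\<^esub> ((c \<odot>\<^bsub>V\<^esub> w) \<oplus>\<^bsub>V\<^esub> (d \<odot>\<^bsub>V\<^esub> z)))"
      by (elim bexE)
    define f where "f = (\<lambda>y. if y = u then a else if y = v then b else if y = w then c else d)"
    have f: "f \<in> {u, v, w, z} \<rightarrow> carrier K" using K by (auto simp: f_def)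
    have "x = lincomb f {u, v, w, z}"
    proof -
      have "f u = a" "f v = b" "f w = c" "f z = d" using dist by (auto simp: f_def)
      then show ?thesis by (simp only: lincomb[OF f] x)
    qed
    with f show "x \<in> span {u, v, w, z}"
      using finite_span[OF _ mem] by auto
  qed
  moreover have "span {u, v, w, z} \<subseteq> carrier V"
    using mem by (rule span_is_subset2)
  ultimately show ?thesis
    using mem unfolding basis_def by auto
qed

text \<open>Euler's formulas: \<open>2 cos t\<close> is the sum of the two conjugate exponentials, with coefficients
  \<open>1, 1\<close>, and \<open>2 sin t\<close> is their difference divided by \<open>i\<close>. The entry \<open>(a, b)\<close> depends on \<open>b - a\<close> while the
  first diagonal coefficient of \<open>embed\<close> multiplies \<open>\<omega>^(a - b)\<close>, which is why it is \<open>i\<close>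
  and not \<open>-i\<close> for the sine.\<close>

lemma U_eq_embed:
  fixes n :: nat and j :: int
  defines "\<omega> \<equiv> cis (2 * real_of_int j * pi / real n)"
  assumes h: "harmonic_pair n \<omega>"
  shows "U n j = harmonic_pair.embed n \<omega> (1\<^sub>m 2)"
    and "U' n j = harmonic_pair.embed n \<omega> (mat2 \<i> 0 0 (- \<i>))"
proof -
  interpret harmonic_pair n \<omega> by (rule h)
  define \<theta> where "\<theta> = 2 * real_of_int j * pi / real n"
  have pow: "\<omega> ^ k = cis (real k * \<theta>)" "inverse \<omega> ^ k = cis (- (real k * \<theta>))" for k
    unfolding \<omega>_def by (simp_all add: DeMoivre \<theta>_def)
  have angle: "(2 * real b - 2 * real a) * real_of_int j * pi / real n = real b * \<theta> - real a * \<theta>"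
    for a b :: nat
    by (simp add: \<theta>_def diff_divide_distrib left_diff_distrib right_diff_distrib mult_ac)
  show "U n j = embed (1\<^sub>m 2)"
    unfolding mat2_one
  proof (intro eq_matI)
    fix a b assume "a < dim_row (embed (mat2 1 0 0 1))" "b < dim_col (embed (mat2 1 0 0 1))"
    then have "a < n" "b < n" by simp_all
    then show "U n j $$ (a, b) = embed (mat2 1 0 0 1) $$ (a, b)"
      by (simp add: U_def embed_mat2_entry pow angle cis_mult)
         (simp add: complex_eq_iff cos_diff sin_diff)
  qed (simp_all add: U_def)
  show "U' n j = embed (mat2 \<i> 0 0 (- \<i>))"
  proof (intro eq_matI)
    fix a b assume "a < dim_row (embed (mat2 \<i> 0 0 (- \<i>)))"
      "b < dim_col (embed (mat2 \<i> 0 0 (- \<i>)))"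
    then have "a < n" "b < n" by simp_all
    then show "U' n j $$ (a, b) = embed (mat2 \<i> 0 0 (- \<i>)) $$ (a, b)"
      by (simp add: U'_def embed_mat2_entry pow angle cis_mult)
         (simp add: complex_eq_iff cos_diff sin_diff)
  qed (simp_all add: U'_def)
qed

text \<open>The bounds put the angle strictly between \<open>0\<close> and \<open>\<pi>\<close>, where the sine is positive, so \<open>\<omega>\<close> is
  neither \<open>1\<close> nor \<open>-1\<close>.\<close>

lemma harmonic_pair_cis:
  assumes n: "n > 0" and j: "0 < j" "2 * j < int n"
  shows "harmonic_pair n (cis (2 * real_of_int j * pi / real n))"
proof
  let ?\<theta> = "2 * real_of_int j * pi / real n"
  show "n > 0" by (rule n)
  have "cis ?\<theta> ^ n = cis (2 * pi * real_of_int j)"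
    using n by (simp add: DeMoivre mult_ac)
  then show "cis ?\<theta> ^ n = 1" by (simp add: cis_multiple_2pi)
  have "?\<theta> < pi"
  proof -
    have "real_of_int (2 * j) < real_of_int (int n)" using j(2) by (simp only: of_int_less_iff)
    then show ?thesis using n by (simp add: field_simps)
  qed
  moreover have "0 < ?\<theta>" using n j by simp
  ultimately have "sin ?\<theta> > 0" by (intro sin_gt_zero)
  then have "Im (cis ?\<theta>) \<noteq> 0" by (simp only: cis.sel)
  then show "(cis ?\<theta>)\<^sup>2 \<noteq> 1"
    by (metis power2_eq_1_iff one_complex.sel(2) uminus_complex.sel(2) neg_0_equal_iff_equal)
qed

theorem theorem5:
  fixes n :: nat and j :: int and q1 q2 q3 q4 :: "complex mat"
  assumes n: "n \<ge> 3"
    and j: "1 \<le> j"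
    and j_odd: "odd n \<Longrightarrow> real_of_int j \<le> (real n - 1) / 2"
    and j_even: "\<And>m. n = 2 * m \<Longrightarrow> j \<le> int m - 1"
    and q1: "q1 = U n j"
    and q2: "q2 = \<i> \<cdot>\<^sub>m (perm_matrix n (reflC n) * U n j)"
    and q3: "q3 = U' n j"
    and q4: "q4 = \<i> \<cdot>\<^sub>m (perm_matrix n (reflC n) * U' n j)"
  shows "card {q1, q2, q3, q4} = 4
    \<and> vectorspace.basis class_ring (MM_component_space n j) {q1, q2, q3, q4}
    \<and> (\<forall>q \<in> {q1, q2, q3, q4}. q1 * q = q \<and> q * q1 = q)
    \<and> q2 * q2 = - q1 \<and> q3 * q3 = - q1 \<and> q4 * q4 = - q1
    \<and> q2 * q3 * q4 = - q1"
proof -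
  define \<omega> where "\<omega> = cis (2 * real_of_int j * pi / real n)"
  have "2 * j < int n"
  proof (cases "even n")
    case True
    then obtain m where "n = 2 * m" by (rule evenE)
    with j_even[of m] show ?thesis by simp
  next
    case False
    with j_odd have "real_of_int (2 * j) < real_of_int (int n)" by simp
    then show ?thesis by (simp only: of_int_less_iff)
  qed
  then have h: "harmonic_pair n \<omega>"
    unfolding \<omega>_def using n j by (intro harmonic_pair_cis) auto
  interpret harmonic_pair n \<omega> by (rule h)
  (* The preimages of q1, ..., q4: writing F for refl2 and D for diag(i, -i), they are 1, i F, D, i F D. *)
  let ?k1 = "mat2 1 0 0 1" and ?k2 = "mat2 0 (\<i> * \<omega>) (\<i> * inverse \<omega>) 0"
    and ?k3 = "mat2 \<i> 0 0 (- \<i>)" and ?k4 = "mat2 0 \<omega> (- inverse \<omega>) 0"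
  have U: "U n j = embed (1\<^sub>m 2)" "U' n j = embed ?k3"
    using U_eq_embed[of n j] h unfolding \<omega>_def by blast+
  have ii: "\<i> * (x * \<i>) = - x" for x
    by (simp add: mult.left_commute[of _ x])
  have q: "q1 = embed ?k1" "q2 = embed ?k2" "q3 = embed ?k3" "q4 = embed ?k4"
    using intertwine_embed[OF perm_matrix_carrier refl2_carrier _ reflection_frame]
    by (simp_all add: q1 q2 q3 q4 U ii mat2_one refl2_def mat2_simps flip: embed_smult)
  have inj: "embed K = embed L \<longleftrightarrow> K = L" if "K \<in> carrier_mat 2 2" "L \<in> carrier_mat 2 2" for K L
    using embed_inject that by blast
  have card: "card {q1, q2, q3, q4} = 4"
    by (simp add: q inj mat2_eq_iff)
  have comb: "a \<cdot>\<^sub>m q1 + (b \<cdot>\<^sub>m q2 + (c \<cdot>\<^sub>m q3 + d \<cdot>\<^sub>m q4))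
      = embed (mat2 (a + c * \<i>) ((b * \<i> + d) * \<omega>) ((b * \<i> - d) * inverse \<omega>) (a - c * \<i>))" for a b c d
    by (simp add: q mat2_simps algebra_simps flip: embed_smult embed_add)
  have space: "carrier (MM_component_space n j) = embed ` carrier_mat 2 2"
    "add (MM_component_space n j) = (+)" "zero (MM_component_space n j) = 0\<^sub>m n n"
    "module.smult (MM_component_space n j) = (\<cdot>\<^sub>m)"
    by (simp_all add: MM_component_space_def MM_component_def U ideal_eq_range_embed module_mat_simps)
  have zero: "0\<^sub>m n n = embed (mat2 0 0 0 0)"
  proof -
    have "embed (mat2 0 0 0 0) = embed (0 \<cdot>\<^sub>m mat2 0 0 0 0)" by (simp add: mat2_smult)
    also have "\<dots> = 0 \<cdot>\<^sub>m embed (mat2 0 0 0 0)" by (rule embed_smult) simp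
    also have "\<dots> = 0\<^sub>m n n" by (intro eq_matI) auto
    finally show ?thesis by simp
  qed
  have "vectorspace.basis class_ring (MM_component_space n j) {q1, q2, q3, q4}"
  proof (rule vectorspace.basis_of_four[OF vectorspace_MM_component], unfold space)
    show "{q1, q2, q3, q4} \<subseteq> embed ` carrier_mat 2 2" by (auto simp: q)
    show "card {q1, q2, q3, q4} = 4" by (rule card)
  next
    fix M assume "M \<in> embed ` carrier_mat 2 2"
    then obtain a b c d where M: "M = embed (mat2 a b c d)" by (auto elim: mat2_cases)
    (* The coefficients invert the linear map in comb: half sums and half differences of the
       entries, after the factors \<omega> and inverse \<omega> are removed from the off-diagonal ones. *)
    have "mat2 a b c d = mat2 (x + z * \<i>) ((y * \<i> + w) * \<omega>) ((y * \<i> - w) * inverse \<omega>) (x - z * \<i>)"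
      if "x = (a + d) / 2" "z = (a - d) / (2 * \<i>)"
        "y = (b * inverse \<omega> + c * \<omega>) / (2 * \<i>)" "w = (b * inverse \<omega> - c * \<omega>) / 2" for x y z w
    proof -
      have half: "u / (2 * \<i>) * \<i> = u / 2" for u :: complex
        by (simp only: times_divide_eq_left mult_divide_mult_cancel_right complex_i_not_zero
            not_False_eq_True)
      have zy: "z * \<i> = (a - d) / 2" "y * \<i> = (b * inverse \<omega> + c * \<omega>) / 2"
        unfolding that by (rule half)+
      have "x + z * \<i> = a" "x - z * \<i> = d" "y * \<i> + w = b * inverse \<omega>" "y * \<i> - w = c * \<omega>"
        unfolding zy that by (simp_all add: field_simps)
      then show ?thesis by (simp add: mat2_eq_iff)
    qed
    then have "\<exists>x y z w. M = x \<cdot>\<^sub>m q1 + (y \<cdot>\<^sub>m q2 + (z \<cdot>\<^sub>m q3 + w \<cdot>\<^sub>m q4))"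
      unfolding comb M by metis
    then show "\<exists>x\<in>carrier class_ring. \<exists>y\<in>carrier class_ring. \<exists>z\<in>carrier class_ring. \<exists>w\<in>carrier class_ring.
        M = x \<cdot>\<^sub>m q1 + (y \<cdot>\<^sub>m q2 + (z \<cdot>\<^sub>m q3 + w \<cdot>\<^sub>m q4))" by simp
  next
    fix a b c d :: complex
    assume "a \<cdot>\<^sub>m q1 + (b \<cdot>\<^sub>m q2 + (c \<cdot>\<^sub>m q3 + d \<cdot>\<^sub>m q4)) = 0\<^sub>m n n"
    then have "a + c * \<i> = 0 \<and> (b * \<i> + d) * \<omega> = 0
        \<and> (b * \<i> - d) * inverse \<omega> = 0 \<and> a - c * \<i> = 0"
      by (simp only: comb zero inj mat2_carrier mat2_eq_iff)
    then have "a + c * \<i> = 0" "a - c * \<i> = 0" "b * \<i> + d = 0" "b * \<i> - d = 0"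
      by (simp_all only: mult_eq_0_iff nonzero inverse_nonzero_iff_nonzero simp_thms)
    moreover have "u = 0 \<and> v = 0" if "u + v = 0" "u - v = 0" for u v :: complex
      using that by (auto simp: complex_eq_iff)
    ultimately have "a = 0" "c * \<i> = 0" "b * \<i> = 0" "d = 0" by blast+
    then show "a = zero class_ring \<and> b = zero class_ring \<and> c = zero class_ring \<and> d = zero class_ring"
      by simp
  qed
  moreover have "(\<forall>p \<in> {q1, q2, q3, q4}. q1 * p = p \<and> p * q1 = p)
    \<and> q2 * q2 = - q1 \<and> q3 * q3 = - q1 \<and> q4 * q4 = - q1 \<and> q2 * q3 * q4 = - q1"
    by (simp add: q embed_mult mat2_simps flip: embed_uminus) (simp add: field_simps)
  ultimately show ?thesis using card by blast
qed

end
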